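(* Let $G$ be a connected graph with $\chi_D(G)=2$. Then $\chi_D(G\cup G)=3$ if and only if $G$ is a bipartite graph whose automorphism group is $\mathrm{Aut}(G)\cong\mathbb{Z}_2=\{\mathrm{id},f\}$, where $\mathrm{Fix}(f)=\emptyset$ and $f$ maps each of the two parts of the bipartition of $G$ onto the other.
   Context: $G\cup G$ is the disjoint union of two copies of $G$. A distinguishing $k$-coloring of a graph is a partition of its vertex set into exactly $k$ non-empty independent sets such that the only automorphism mapping every class onto itself is the identity; $\chi_D$ is the least such $k$. For $f\in\mathrm{Aut}(G)$, $\mathrm{Fix}(f)=\{v\in V(G): f(v)=v\}$. *)

theory Defs
  imports
    "Graph_Theory.Pair_Digraph"
    "Graph_Theory.Digraph_Component"
    "HOL-Algebra.Bij"
    "HOL-Algebra.Elementary_Groups"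
    "HOL-Library.Disjoint_Sets"
    "HOL-Library.Extended_Nat"
begin

text \<open>
  A (simple, undirected, possibly infinite) graph is a symmetric loop-free pair digraph, i.e. one
  satisfying \<^locale>\<open>pair_bidirected_digraph\<close>: an edge between \<open>u\<close> and \<open>v\<close> is
  represented by the two arcs \<open>(u, v)\<close> and \<open>(v, u)\<close>.
\<close>

definition independent_set :: "'a pair_pre_digraph \<Rightarrow> 'a set \<Rightarrow> bool" where
  "independent_set G S \<longleftrightarrow>
     S \<subseteq> pverts G \<and> (\<forall>u\<in>S. \<forall>v\<in>S. (u, v) \<notin> parcs G)"

text \<open>
  Elements of \<^term>\<open>Bij S\<close> are extensional, so automorphisms are determined by their values on
  vertices; the group operation and unit are those of \<^term>\<open>BijGroup (pverts G)\<close>.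
\<close>

definition graph_automorphisms :: "'a pair_pre_digraph \<Rightarrow> ('a \<Rightarrow> 'a) set" where
  "graph_automorphisms G =
     {f \<in> Bij (pverts G).
        \<forall>u\<in>pverts G. \<forall>v\<in>pverts G. (f u, f v) \<in> parcs G \<longleftrightarrow> (u, v) \<in> parcs G}"

definition Aut_group :: "'a pair_pre_digraph \<Rightarrow> ('a \<Rightarrow> 'a) monoid" where
  "Aut_group G = BijGroup (pverts G) \<lparr>carrier := graph_automorphisms G\<rparr>"

definition Fix :: "'a pair_pre_digraph \<Rightarrow> ('a \<Rightarrow> 'a) \<Rightarrow> 'a set" where
  "Fix G f = {v \<in> pverts G. f v = v}"

definition distinguishing_coloring :: "'a pair_pre_digraph \<Rightarrow> nat \<Rightarrow> 'a set set \<Rightarrow> bool" where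
  "distinguishing_coloring G k P \<longleftrightarrow>
     partition_on (pverts G) P \<and> finite P \<and> card P = k \<and>
     (\<forall>C\<in>P. independent_set G C) \<and>
     (\<forall>f\<in>graph_automorphisms G. (\<forall>C\<in>P. f ` C = C) \<longrightarrow> (\<forall>v\<in>pverts G. f v = v))"

text \<open>
  The value is \<open>\<infinity>\<close> if no distinguishing coloring with finitely many classes exists, which
  can only happen for infinite graphs.
\<close>

definition distinguishing_chromatic_number :: "'a pair_pre_digraph \<Rightarrow> enat" (\<open>\<chi>\<^sub>D\<close>) where
  "\<chi>\<^sub>D G = (INF k \<in> {k. \<exists>P. distinguishing_coloring G k P}. enat k)"

definition bipartition :: "'a pair_pre_digraph \<Rightarrow> 'a set \<Rightarrow> 'a set \<Rightarrow> bool" where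
  "bipartition G X Y \<longleftrightarrow>
     X \<union> Y = pverts G \<and> X \<inter> Y = {} \<and> independent_set G X \<and> independent_set G Y"

definition bipartite :: "'a pair_pre_digraph \<Rightarrow> bool" where
  "bipartite G \<longleftrightarrow> (\<exists>X Y. bipartition G X Y)"

definition disjoint_graph_union ::
    "'a pair_pre_digraph \<Rightarrow> 'b pair_pre_digraph \<Rightarrow> ('a + 'b) pair_pre_digraph" (infixl \<open>\<uplus>\<^sub>g\<close> 65) where
  "G \<uplus>\<^sub>g H =
     \<lparr>pverts = pverts G <+> pverts H,
      parcs = map_prod Inl Inl ` parcs G \<union> map_prod Inr Inr ` parcs H\<rparr>"

end

theory Submission
  imports Defs
begin

text \<open>
  An automorphism of a connected bipartite graph preserves or exchanges the two parts. If a
  2-colouring is distinguishing, an automorphism preserving the parts is trivial, so there is at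
  most one nontrivial automorphism \<open>f\<close>, and it exchanges the parts. Automorphisms of \<open>G \<union> G\<close>
  either preserve or exchange the two copies. If \<open>f\<close> does not exist, colouring the two copies with
  opposite orientations is distinguishing with two colours. If \<open>f\<close> exists, every 2-colouring of
  \<open>G \<union> G\<close> is preserved by the exchange of the copies or by that exchange composed with \<open>f\<close>, whereas
  giving one part of each copy its own colour distinguishes with three colours.
\<close>

section \<open>Connectedness, automorphisms and independent sets\<close>

lemma connected_imp_constant:
  assumes "connected (with_proj G)"
    and "\<And>u v. (u, v) \<in> parcs G \<Longrightarrow> P u = P v"
    and "u \<in> pverts G" "v \<in> pverts G"
  shows "P u = P v"
proof -
  \<comment> \<open>\<open>connected\<close> means strong connectedness of the symmetric closure, so
    a step of the walk may use an arc in either direction; the hypothesis on arcs covers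
    both.\<close>
  have "(u, v) \<in> rtrancl_on (pverts G) (parcs (mk_symmetric (with_proj G)))"
    using assms(1,3,4) by (auto simp: connected_def strongly_connected_def reachable_def)
  then show ?thesis
  proof induction
    case (step y z)
    then have "P y = P z"
      using assms(2)[of y z] assms(2)[of z y] by (auto simp: parcs_mk_symmetric)
    with step show ?case
      by simp
  qed simp
qed

lemma connected_imp_nonempty: "connected (with_proj G) \<Longrightarrow> pverts G \<noteq> {}"
  by (auto simp: connected_def strongly_connected_def)

lemma graph_automorphismsI:
  assumes "f \<in> extensional (pverts G)" "bij_betw f (pverts G) (pverts G)"
    and "\<And>u v. u \<in> pverts G \<Longrightarrow> v \<in> pverts G \<Longrightarrow> (f u, f v) \<in> parcs G \<longleftrightarrow> (u, v) \<in> parcs G"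
  shows "f \<in> graph_automorphisms G"
  using assms by (auto simp: graph_automorphisms_def Bij_def)

lemma graph_automorphisms_bij_betw:
  "f \<in> graph_automorphisms G \<Longrightarrow> bij_betw f (pverts G) (pverts G)"
  by (auto simp: graph_automorphisms_def Bij_def)

lemma graph_automorphisms_in_pverts:
  "f \<in> graph_automorphisms G \<Longrightarrow> v \<in> pverts G \<Longrightarrow> f v \<in> pverts G"
  using graph_automorphisms_bij_betw bij_betw_apply by metis

lemma graph_automorphisms_arc_iff:
  "f \<in> graph_automorphisms G \<Longrightarrow> u \<in> pverts G \<Longrightarrow> v \<in> pverts G \<Longrightarrow>
    (f u, f v) \<in> parcs G \<longleftrightarrow> (u, v) \<in> parcs G"
  by (auto simp: graph_automorphisms_def)

lemma graph_automorphisms_eqI: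
  assumes "f \<in> graph_automorphisms G" "g \<in> graph_automorphisms G"
    and "\<And>v. v \<in> pverts G \<Longrightarrow> f v = g v"
  shows "f = g"
  using assms by (auto simp: graph_automorphisms_def Bij_def intro: extensionalityI)

lemma id_graph_automorphism: "(\<lambda>v\<in>pverts G. v) \<in> graph_automorphisms G"
  by (auto simp: graph_automorphisms_def id_Bij)

lemma compose_graph_automorphism:
  assumes "f \<in> graph_automorphisms G" "g \<in> graph_automorphisms G"
  shows "compose (pverts G) f g \<in> graph_automorphisms G"
  using assms graph_automorphisms_in_pverts[OF assms(2)]
  by (auto simp: graph_automorphisms_def compose_Bij compose_eq)

lemma independent_set_image:
  assumes "f \<in> graph_automorphisms G" "independent_set G X"
  shows "independent_set G (f ` X)"
proof -
  have "X \<subseteq> pverts G"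
    using assms(2) by (simp add: independent_set_def)
  then show ?thesis
    using assms(2) graph_automorphisms_arc_iff[OF assms(1)] graph_automorphisms_in_pverts[OF assms(1)]
    unfolding independent_set_def by blast
qed

lemma independent_set_empty: "independent_set G {}"
  by (simp add: independent_set_def)

section \<open>Bipartitions and their uniqueness in connected graphs\<close>

lemma bipartition_image:
  assumes "f \<in> graph_automorphisms G" "bipartition G X Y"
  shows "bipartition G (f ` X) (f ` Y)"
proof -
  have "X \<union> Y = pverts G" "X \<inter> Y = {}"
    using assms(2) by (auto simp: bipartition_def)
  moreover have "inj_on f (pverts G)" "f ` pverts G = pverts G"
    using graph_automorphisms_bij_betw[OF assms(1)] by (auto simp: bij_betw_def)
  ultimately have "f ` X \<union> f ` Y = pverts G" "f ` X \<inter> f ` Y = {}"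
    by (metis image_Un, metis Un_upper1 Un_upper2 image_empty inj_on_image_Int)
  then show ?thesis
    using assms independent_set_image by (auto simp: bipartition_def)
qed

lemma bipartition_arc_iff:
  assumes "pair_wf_digraph G" "bipartition G X Y" "(u, v) \<in> parcs G"
  shows "v \<in> X \<longleftrightarrow> u \<notin> X"
proof -
  have "u \<in> X \<union> Y" "v \<in> X \<union> Y"
    using pair_wf_digraph.wellformed'[OF assms(1,3)] assms(2) by (simp_all add: bipartition_def)
  moreover have "\<not> (u \<in> X \<and> v \<in> X)" "\<not> (u \<in> Y \<and> v \<in> Y)"
    using assms(2,3) by (auto simp: bipartition_def independent_set_def)
  ultimately show ?thesis
    using assms(2) by (auto simp: bipartition_def)
qed

text \<open>Along an arc both membership in \<open>X\<close> and membership in \<open>X'\<close>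
  flip, so whether the two agree is constant along arcs. By connectedness they agree at every vertex
  or at none.\<close>

lemma connected_bipartition_unique:
  assumes "pair_wf_digraph G" "connected (with_proj G)"
    and "bipartition G X Y" "bipartition G X' Y'"
  shows "(X' = X \<and> Y' = Y) \<or> (X' = Y \<and> Y' = X)"
proof -
  have const: "(u \<in> X \<longleftrightarrow> u \<in> X') = (v \<in> X \<longleftrightarrow> v \<in> X')"
    if "u \<in> pverts G" "v \<in> pverts G" for u v
  proof (rule connected_imp_constant[OF assms(2) _ that])
    fix u v
    assume "(u, v) \<in> parcs G"
    then show "(u \<in> X \<longleftrightarrow> u \<in> X') = (v \<in> X \<longleftrightarrow> v \<in> X')"
      using bipartition_arc_iff[OF assms(1,3)] bipartition_arc_iff[OF assms(1,4)] by simp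
  qed
  obtain w where "w \<in> pverts G"
    using connected_imp_nonempty[OF assms(2)] by auto
  then have "(\<forall>v\<in>pverts G. v \<in> X \<longleftrightarrow> v \<in> X') \<or> (\<forall>v\<in>pverts G. v \<in> X \<longleftrightarrow> v \<notin> X')"
    using const by blast
  then show ?thesis
    using assms(3,4) unfolding bipartition_def by blast
qed

section \<open>The distinguishing chromatic number and colorings that attain it\<close>

lemma distinguishing_chromatic_number_le_iff:
  "\<chi>\<^sub>D G \<le> enat k \<longleftrightarrow> (\<exists>j\<le>k. \<exists>P. distinguishing_coloring G j P)"
proof
  let ?K = "enat ` {k. \<exists>P. distinguishing_coloring G k P}"
  assume *: "\<chi>\<^sub>D G \<le> enat k"
  \<comment> \<open>The infimum of the empty set is infinity, which the finite bound excludes. For a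
    nonempty set of \<open>enat\<close> values the infimum is the least element, hence attained by a
    coloring.\<close>
  then have "?K \<noteq> {}"
    unfolding distinguishing_chromatic_number_def Inf_enat_def by (auto split: if_splits)
  then have "(LEAST x. x \<in> ?K) \<in> ?K"
    by (metis LeastI ex_in_conv)
  with \<open>?K \<noteq> {}\<close> have "\<chi>\<^sub>D G \<in> ?K"
    unfolding distinguishing_chromatic_number_def Inf_enat_def by (simp only: if_False)
  with * show "\<exists>j\<le>k. \<exists>P. distinguishing_coloring G j P"
    by auto
next
  assume "\<exists>j\<le>k. \<exists>P. distinguishing_coloring G j P"
  then obtain j P where "j \<le> k" "distinguishing_coloring G j P"
    by blast
  then have "\<chi>\<^sub>D G \<le> enat j"
    unfolding distinguishing_chromatic_number_def by (auto intro: INF_lower)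
  with \<open>j \<le> k\<close> show "\<chi>\<^sub>D G \<le> enat k"
    by (meson enat_ord_simps(1) order_trans)
qed

text \<open>Splits an exact value into two bounds, each of which the preceding lemma turns into the
  existence or absence of colorings.\<close>

lemma distinguishing_chromatic_number_eq_Suc_iff:
  "\<chi>\<^sub>D G = enat (Suc k) \<longleftrightarrow> \<chi>\<^sub>D G \<le> enat (Suc k) \<and> \<not> \<chi>\<^sub>D G \<le> enat k"
  by (cases "\<chi>\<^sub>D G") auto

lemma distinguishing_coloring_partition_on:
  "distinguishing_coloring G k P \<Longrightarrow> partition_on (pverts G) P"
  by (simp add: distinguishing_coloring_def)

lemma distinguishing_coloring_fixes:
  assumes "distinguishing_coloring G k P" "f \<in> graph_automorphisms G"
    and "\<And>C. C \<in> P \<Longrightarrow> f ` C = C" "v \<in> pverts G"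
  shows "f v = v"
  using assms unfolding distinguishing_coloring_def by blast

lemma distinguishing_coloring_2_cases:
  assumes "distinguishing_coloring G 2 P"
  obtains X Y where "P = {X, Y}" "X \<noteq> {}" "Y \<noteq> {}" "bipartition G X Y"
proof -
  obtain X Y where P: "P = {X, Y}" "X \<noteq> Y"
    using assms by (auto simp: distinguishing_coloring_def card_2_iff)
  moreover have "X \<noteq> {}" "Y \<noteq> {}" "bipartition G X Y"
    using assms P by (auto simp: distinguishing_coloring_def bipartition_def partition_on_def disjoint_def)
  ultimately show ?thesis
    using that by blast
qed

section \<open>The automorphism group\<close>

lemma group_order_2_iso:
  assumes "carrier M = {\<one>\<^bsub>M\<^esub>, f}" "f \<noteq> \<one>\<^bsub>M\<^esub>"
    and "group M"
  shows "M \<cong> integer_mod_group 2"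
proof -
  interpret group M by fact
  have f: "f \<in> carrier M" and "\<And>x. x \<in> carrier M \<Longrightarrow> x = \<one>\<^bsub>M\<^esub> \<or> x = f"
    using assms(1) by auto
  \<comment> \<open>The only alternative is that the square of \<open>f\<close> is \<open>f\<close>
    itself, and cancellation would then make \<open>f\<close> the unit.\<close>
  then have "f \<otimes>\<^bsub>M\<^esub> f = \<one>\<^bsub>M\<^esub>"
    using assms(2) by (metis l_cancel_one m_closed)
  then have "(\<lambda>x. if x = f then 1 else 0) \<in> iso M (integer_mod_group 2)"
    using assms(1,2) f
    by (auto simp: iso_def hom_def bij_betw_def inj_on_def carrier_integer_mod_group)
  then show ?thesis
    by (auto simp: is_iso_def)
qed

lemma Aut_group_simps [simp]:
  "carrier (Aut_group G) = graph_automorphisms G"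
  "\<one>\<^bsub>Aut_group G\<^esub> = (\<lambda>v\<in>pverts G. v)"
  by (auto simp: Aut_group_def BijGroup_def)

text \<open>The automorphisms form a subgroup of the group of all bijections of the vertex set. The
  substantial point is closure under inverses: the arc equivalence for \<open>f\<close> is applied
  to the preimages of two given vertices.\<close>

lemma group_Aut_group: "group (Aut_group G)"
proof -
  interpret B: group "BijGroup (pverts G)" by (rule group_BijGroup)
  have sub: "graph_automorphisms G \<subseteq> Bij (pverts G)"
    by (auto simp: graph_automorphisms_def)
  have "subgroup (graph_automorphisms G) (BijGroup (pverts G))"
  proof (rule B.subgroupI)
    fix f assume f: "f \<in> graph_automorphisms G"
    let ?g = "\<lambda>v\<in>pverts G. inv_into (pverts G) f v"
    have bij: "bij_betw f (pverts G) (pverts G)"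
      using f by (rule graph_automorphisms_bij_betw)
    have "f \<in> Bij (pverts G)"
      using f sub by blast
    then have "inv\<^bsub>BijGroup (pverts G)\<^esub> f = ?g"
      by (intro B.inv_equality)
        (auto simp: BijGroup_def Bij_compose_restrict_eq restrict_inv_into_Bij)
    moreover have "?g \<in> graph_automorphisms G"
    proof -
      have "(?g u, ?g v) \<in> parcs G \<longleftrightarrow> (u, v) \<in> parcs G" if "u \<in> pverts G" "v \<in> pverts G" for u v
      proof -
        have "inv_into (pverts G) f w \<in> pverts G \<and> f (inv_into (pverts G) f w) = w"
          if "w \<in> pverts G" for w
          using bij that by (metis bij_betw_def f_inv_into_f inv_into_into)
        with that graph_automorphisms_arc_iff[OF f] show ?thesis
          by (metis restrict_apply')
      qed
      then show ?thesis
        using restrict_inv_into_Bij[OF \<open>f \<in> Bij (pverts G)\<close>]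
        by (simp add: graph_automorphisms_def)
    qed
    ultimately show "inv\<^bsub>BijGroup (pverts G)\<^esub> f \<in> graph_automorphisms G"
      by simp
  next
    fix f g assume "f \<in> graph_automorphisms G" "g \<in> graph_automorphisms G"
    then show "f \<otimes>\<^bsub>BijGroup (pverts G)\<^esub> g \<in> graph_automorphisms G"
      using compose_graph_automorphism sub by (auto simp: BijGroup_def subset_iff)
  qed (use sub id_graph_automorphism in \<open>auto simp: BijGroup_def\<close>)
  then show ?thesis
    unfolding Aut_group_def by (rule B.subgroup_imp_group)
qed

section \<open>Disjoint unions and their automorphisms\<close>

lemma disjoint_graph_union_simps [simp]:
  "pverts (G \<uplus>\<^sub>g H) = pverts G <+> pverts H"
  "(Inl u, Inl v) \<in> parcs (G \<uplus>\<^sub>g H) \<longleftrightarrow> (u, v) \<in> parcs G"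
  "(Inr x, Inr y) \<in> parcs (G \<uplus>\<^sub>g H) \<longleftrightarrow> (x, y) \<in> parcs H"
  "(Inl u, Inr y) \<notin> parcs (G \<uplus>\<^sub>g H)"
  "(Inr x, Inl v) \<notin> parcs (G \<uplus>\<^sub>g H)"
  by (auto simp: disjoint_graph_union_def)

lemma Inl_in_Plus_iff: "Inl x \<in> A <+> B \<longleftrightarrow> x \<in> A"
  by auto

lemma Inr_in_Plus_iff: "Inr x \<in> A <+> B \<longleftrightarrow> x \<in> B"
  by auto

lemma Plus_eq_Plus_iff: "A <+> B = C <+> D \<longleftrightarrow> A = C \<and> B = D"
  by (simp add: set_eq_iff split_sum_all Inl_in_Plus_iff Inr_in_Plus_iff)

lemma independent_set_disjoint_graph_union_iff:
  "independent_set (G \<uplus>\<^sub>g H) C \<longleftrightarrow> independent_set G (Inl -` C) \<and> independent_set H (Inr -` C)"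
  (is "?L \<longleftrightarrow> ?R")
proof
  show "?L \<Longrightarrow> ?R"
    by (fastforce simp: independent_set_def)
next
  assume R: ?R
  have "x \<in> pverts G <+> pverts H" if "x \<in> C" for x
    using R that by (cases x) (auto simp: independent_set_def)
  moreover have "(x, y) \<notin> parcs (G \<uplus>\<^sub>g H)" if "x \<in> C" "y \<in> C" for x y
    using R that by (cases x; cases y) (auto simp: independent_set_def)
  ultimately show ?L
    by (auto simp: independent_set_def)
qed

lemma independent_set_Plus [simp]:
  "independent_set (G \<uplus>\<^sub>g H) (A <+> B) \<longleftrightarrow> independent_set G A \<and> independent_set H B"
proof -
  have "Inl -` (A <+> B) = A" "Inr -` (A <+> B) = B"
    by auto
  then show ?thesis
    by (simp add: independent_set_disjoint_graph_union_iff)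
qed

text \<open>The exchange of the two copies, twisted by \<open>g\<close>. It is applied below with
  \<open>g\<close> the identity and with \<open>g\<close> the automorphism that exchanges the parts
  of \<open>G\<close>.\<close>

lemma swap_graph_automorphism:
  assumes g: "g \<in> graph_automorphisms G"
  shows "(\<lambda>x\<in>pverts G <+> pverts G. case x of Inl v \<Rightarrow> Inr (g v) | Inr v \<Rightarrow> Inl (g v))
    \<in> graph_automorphisms (G \<uplus>\<^sub>g G)" (is "?s \<in> _")
proof (rule graph_automorphismsI)
  have "inj_on g (pverts G)" "g ` pverts G = pverts G"
    using graph_automorphisms_bij_betw[OF g] by (auto simp: bij_betw_def)
  moreover from this(2) have "\<And>v. v \<in> pverts G \<Longrightarrow> \<exists>u\<in>pverts G. v = g u"
    by blast
  ultimately show "bij_betw ?s (pverts (G \<uplus>\<^sub>g G)) (pverts (G \<uplus>\<^sub>g G))"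
    unfolding bij_betw_def disjoint_graph_union_simps
    by (fastforce simp: inj_on_def Plus_def image_Un image_image)
next
  fix u v assume "u \<in> pverts (G \<uplus>\<^sub>g G)" "v \<in> pverts (G \<uplus>\<^sub>g G)"
  then show "(?s u, ?s v) \<in> parcs (G \<uplus>\<^sub>g G) \<longleftrightarrow> (u, v) \<in> parcs (G \<uplus>\<^sub>g G)"
    using graph_automorphisms_arc_iff[OF g] by auto
qed simp

text \<open>Leaving \<open>e\<close> and \<open>e'\<close> open treats uniformly the automorphisms
  that keep a copy and those that move it to the other one.\<close>

lemma graph_automorphism_restrict_summand:
  assumes s: "s \<in> graph_automorphisms (G \<uplus>\<^sub>g G)"
    and e: "e = Inl \<or> e = Inr" and e': "e' = Inl \<or> e' = Inr"
    and im: "s ` e ` pverts G = e' ` pverts G"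
  obtains g where "g \<in> graph_automorphisms G" "\<And>v. v \<in> pverts G \<Longrightarrow> s (e v) = e' (g v)"
proof (rule that)
  \<comment> \<open>\<open>case_sum id id\<close> strips whichever injection is present; restricting
    to the vertex set makes \<open>g\<close> extensional, as membership in \<open>Bij\<close>
    demands.\<close>
  define g where "g = (\<lambda>v\<in>pverts G. case_sum id id (s (e v)))"
  have inj: "inj e" "inj e'"
    using e e' by auto
  have arcs: "(e u, e v) \<in> parcs (G \<uplus>\<^sub>g G) \<longleftrightarrow> (u, v) \<in> parcs G"
    "(e' u, e' v) \<in> parcs (G \<uplus>\<^sub>g G) \<longleftrightarrow> (u, v) \<in> parcs G" for u v
    using e e' by auto
  have in_union: "e v \<in> pverts (G \<uplus>\<^sub>g G)" if "v \<in> pverts G" for v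
    using e that by auto
  show s_eq: "s (e v) = e' (g v)" if "v \<in> pverts G" for v
  proof -
    have "s (e v) \<in> e' ` pverts G"
      unfolding im[symmetric] using that by simp
    then obtain w where w: "s (e v) = e' w"
      by (rule imageE)
    from e' have "case_sum id id (e' w) = w"
      by (elim disjE) simp_all
    with w that show ?thesis
      by (simp add: g_def)
  qed
  show "g \<in> graph_automorphisms G"
  proof (rule graph_automorphismsI)
    have "inj_on g (pverts G)"
    proof (rule inj_onI)
      fix u v assume uv: "u \<in> pverts G" "v \<in> pverts G" "g u = g v"
      then have "s (e u) = s (e v)"
        by (simp add: s_eq)
      then have "e u = e v"
        by (rule inj_onD[OF bij_betw_imp_inj_on[OF graph_automorphisms_bij_betw[OF s]]])
          (use in_union uv in blast)+
      then show "u = v"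
        by (rule injD[OF inj(1)])
    qed
    moreover have "e' ` g ` pverts G = e' ` pverts G"
      unfolding im[symmetric] by (simp add: image_image s_eq)
    then have "g ` pverts G = pverts G"
      by (simp only: inj_image_eq_iff[OF inj(2)])
    ultimately show "bij_betw g (pverts G) (pverts G)"
      by (simp add: bij_betw_def)
  next
    fix u v assume "u \<in> pverts G" "v \<in> pverts G"
    then show "(g u, g v) \<in> parcs G \<longleftrightarrow> (u, v) \<in> parcs G"
      using graph_automorphisms_arc_iff[OF s in_union in_union] by (simp add: arcs s_eq)
  qed (simp add: g_def)
qed

text \<open>If \<open>C\<close> and \<open>D\<close> lay in the same one of \<open>A\<close> and
  \<open>B\<close>, the other, being nonempty and disjoint from it, would not be covered. So they
  lie in different ones, and covering forces equality.\<close>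

lemma Un_eq_disjoint_Un_cases:
  assumes "A \<inter> B = {}" "A \<noteq> {}" "B \<noteq> {}" "C \<union> D = A \<union> B"
    and "C \<subseteq> A \<or> C \<subseteq> B" "D \<subseteq> A \<or> D \<subseteq> B"
  shows "C = A \<and> D = B \<or> C = B \<and> D = A"
proof -
  consider "C \<union> D \<subseteq> A" | "C \<union> D \<subseteq> B" | "C \<subseteq> A" "D \<subseteq> B" | "C \<subseteq> B" "D \<subseteq> A"
    using assms(5,6) by blast
  then show ?thesis
  proof cases
    case 1
    then have "B \<subseteq> A"
      unfolding assms(4) by simp
    then show ?thesis
      using assms(1,3) by auto
  next
    case 2
    then have "A \<subseteq> B"
      unfolding assms(4) by simp
    then show ?thesis
      using assms(1,2) by auto
  next
    case 3
    then have "A \<subseteq> C" "B \<subseteq> D"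
      using assms(1,4) by blast+
    with 3 show ?thesis
      by blast
  next
    case 4
    then have "A \<subseteq> D" "B \<subseteq> C"
      using assms(1,4) by blast+
    with 4 show ?thesis
      by blast
  qed
qed

text \<open>No arc joins the two copies, so by connectedness the image of each copy lies within a
  single copy. Surjectivity then makes the two images the two copies in some order. The restrictions
  \<open>g\<close> and \<open>h\<close> may differ.\<close>

lemma connected_union_automorphism_cases:
  assumes wf: "pair_wf_digraph G" and conn: "connected (with_proj G)"
    and s: "s \<in> graph_automorphisms (G \<uplus>\<^sub>g G)"
  obtains (keep) g h where "g \<in> graph_automorphisms G" "h \<in> graph_automorphisms G"
      "\<And>v. v \<in> pverts G \<Longrightarrow> s (Inl v) = Inl (g v)" "\<And>v. v \<in> pverts G \<Longrightarrow> s (Inr v) = Inr (h v)"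
  | (swap) g h where "g \<in> graph_automorphisms G" "h \<in> graph_automorphisms G"
      "\<And>v. v \<in> pverts G \<Longrightarrow> s (Inl v) = Inr (g v)" "\<And>v. v \<in> pverts G \<Longrightarrow> s (Inr v) = Inl (h v)"
proof -
  interpret pair_wf_digraph G by fact
  let ?V = "pverts G"
  have surj: "s ` (?V <+> ?V) = ?V <+> ?V"
    using graph_automorphisms_bij_betw[OF s] by (simp add: bij_betw_def)
  then have surj': "s ` Inl ` ?V \<union> s ` Inr ` ?V = ?V <+> ?V"
    by (simp add: Plus_def image_Un)
  have side: "s ` e ` ?V \<subseteq> Inl ` ?V \<or> s ` e ` ?V \<subseteq> Inr ` ?V" if e: "e = Inl \<or> e = Inr" for e
  proof -
    \<comment> \<open>\<open>isl\<close> records which copy contains the image of a vertex; it is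
      the invariant transported along arcs.\<close>
    have "isl (s (e u)) = isl (s (e v))" if "u \<in> ?V" "v \<in> ?V" for u v
    proof (rule connected_imp_constant[OF conn _ that])
      fix u v assume arc: "(u, v) \<in> parcs G"
      then have "(e u, e v) \<in> parcs (G \<uplus>\<^sub>g G)" "e u \<in> pverts (G \<uplus>\<^sub>g G)" "e v \<in> pverts (G \<uplus>\<^sub>g G)"
        using e by (auto dest: wellformed')
      then have "(s (e u), s (e v)) \<in> parcs (G \<uplus>\<^sub>g G)"
        using graph_automorphisms_arc_iff[OF s] by blast
      then show "isl (s (e u)) = isl (s (e v))"
        by (cases "s (e u)"; cases "s (e v)") auto
    qed
    then have "(\<forall>v\<in>?V. isl (s (e v))) \<or> (\<forall>v\<in>?V. \<not> isl (s (e v)))"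
      by blast
    moreover have "s (e v) \<in> ?V <+> ?V" if "v \<in> ?V" for v
      using e that surj' by blast
    ultimately show ?thesis
      by fastforce
  qed
  have ne: "?V \<noteq> {}"
    using conn by (rule connected_imp_nonempty)
  have "s ` Inl ` ?V = Inl ` ?V \<and> s ` Inr ` ?V = Inr ` ?V \<or>
        s ` Inl ` ?V = Inr ` ?V \<and> s ` Inr ` ?V = Inl ` ?V"
    by (rule Un_eq_disjoint_Un_cases) (use ne surj' side in \<open>auto simp: Plus_def\<close>)
  then show ?thesis
  proof (elim disjE conjE)
    assume im: "s ` Inl ` ?V = Inl ` ?V" "s ` Inr ` ?V = Inr ` ?V"
    obtain g where "g \<in> graph_automorphisms G" "\<And>v. v \<in> ?V \<Longrightarrow> s (Inl v) = Inl (g v)"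
      by (rule graph_automorphism_restrict_summand[OF s _ _ im(1)]) auto
    moreover obtain h where "h \<in> graph_automorphisms G" "\<And>v. v \<in> ?V \<Longrightarrow> s (Inr v) = Inr (h v)"
      by (rule graph_automorphism_restrict_summand[OF s _ _ im(2)]) auto
    ultimately show thesis
      using keep by blast
  next
    assume im: "s ` Inl ` ?V = Inr ` ?V" "s ` Inr ` ?V = Inl ` ?V"
    obtain g where "g \<in> graph_automorphisms G" "\<And>v. v \<in> ?V \<Longrightarrow> s (Inl v) = Inr (g v)"
      by (rule graph_automorphism_restrict_summand[OF s _ _ im(1)]) auto
    moreover obtain h where "h \<in> graph_automorphisms G" "\<And>v. v \<in> ?V \<Longrightarrow> s (Inr v) = Inl (h v)"
      by (rule graph_automorphism_restrict_summand[OF s _ _ im(2)]) auto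
    ultimately show thesis
      using swap by blast
  qed
qed

section \<open>Colorings of the union of two copies\<close>

lemma swap_not_class_preserving:
  assumes "distinguishing_coloring (G \<uplus>\<^sub>g G) k P" "pverts G \<noteq> {}" "g \<in> graph_automorphisms G"
  shows "\<not> (\<forall>C\<in>P. Inr ` g ` (Inl -` C) \<union> Inl ` g ` (Inr -` C) = C)"
proof
  assume *: "\<forall>C\<in>P. Inr ` g ` (Inl -` C) \<union> Inl ` g ` (Inr -` C) = C"
  let ?s = "\<lambda>x\<in>pverts G <+> pverts G. case x of Inl v \<Rightarrow> Inr (g v) | Inr v \<Rightarrow> Inl (g v)"
  \<comment> \<open>Each class is split into its traces on the two copies, and the twisted exchange
    carries each trace, transformed by \<open>g\<close>, to the other copy. The assumption says that
    these images reassemble the class.\<close>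
  have "?s ` C = C" if "C \<in> P" for C
  proof -
    have sub: "C \<subseteq> pverts G <+> pverts G"
      using partition_onD1[OF distinguishing_coloring_partition_on[OF assms(1)]] that by auto
    have "?s (Inl v) = Inr (g v)" if "Inl v \<in> C" for v
      using sub that by auto
    then have Inl: "?s ` Inl ` (Inl -` C) = Inr ` g ` (Inl -` C)"
      unfolding image_image by (intro image_cong) simp_all
    have "?s (Inr v) = Inl (g v)" if "Inr v \<in> C" for v
      using sub that by auto
    then have Inr: "?s ` Inr ` (Inr -` C) = Inl ` g ` (Inr -` C)"
      unfolding image_image by (intro image_cong) simp_all
    have "Inl ` (Inl -` C) \<union> Inr ` (Inr -` C) = C"
      by (auto simp: set_eq_iff split_sum_all)
    then have "?s ` C = Inr ` g ` (Inl -` C) \<union> Inl ` g ` (Inr -` C)"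
      using image_Un[of ?s "Inl ` (Inl -` C)" "Inr ` (Inr -` C)"] unfolding Inl Inr by simp
    then show ?thesis
      using * that by simp
  qed
  note image = this
  obtain v where v: "v \<in> pverts G"
    using assms(2) by auto
  \<comment> \<open>A distinguishing coloring would force the exchange to fix a vertex of the first
    copy, although it sends that vertex to the second.\<close>
  have "?s (Inl v) = Inl v"
    by (rule distinguishing_coloring_fixes[OF assms(1) swap_graph_automorphism[OF assms(3)] image])
      (use v in auto)
  with v show False
    by (simp add: InlI)
qed

text \<open>The class \<open>Y <+> {}\<close> lives in the first copy only, so preserving it
  excludes an exchange of the copies. An automorphism that keeps the copies preserves
  \<open>X\<close> and \<open>Y\<close> in each, and is trivial there because \<open>{X, Y}\<close>
  is distinguishing for \<open>G\<close>.\<close>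

lemma union_coloring_3:
  assumes wf: "pair_wf_digraph G" and conn: "connected (with_proj G)"
    and col: "distinguishing_coloring G 2 {X, Y}"
    and ne: "X \<noteq> {}" "Y \<noteq> {}" and bip: "bipartition G X Y"
  shows "distinguishing_coloring (G \<uplus>\<^sub>g G) 3 {X <+> X, Y <+> {}, {} <+> Y}"
proof -
  have XY: "X \<union> Y = pverts G" "X \<inter> Y = {}" "independent_set G X" "independent_set G Y"
    using bip by (auto simp: bipartition_def)
  have "partition_on (pverts (G \<uplus>\<^sub>g G)) {X <+> X, Y <+> {}, {} <+> Y}"
    by (rule partition_onI) (use XY ne in \<open>auto simp: disjnt_def\<close>)
  moreover have "card {X <+> X, Y <+> {}, {} <+> Y} = 3"
  proof -
    have "X <+> X \<noteq> Y <+> {}" "X <+> X \<noteq> {} <+> Y" "Y <+> {} \<noteq> {} <+> Y"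
      using ne by auto
    then show ?thesis
      by simp
  qed
  moreover have "\<forall>C\<in>{X <+> X, Y <+> {}, {} <+> Y}. independent_set (G \<uplus>\<^sub>g G) C"
    using XY by (simp add: independent_set_empty)
  moreover have "\<forall>v\<in>pverts (G \<uplus>\<^sub>g G). s v = v"
    if s: "s \<in> graph_automorphisms (G \<uplus>\<^sub>g G)"
      and pres: "\<forall>C\<in>{X <+> X, Y <+> {}, {} <+> Y}. s ` C = C" for s
    using wf conn s
  proof (cases rule: connected_union_automorphism_cases)
    case (keep g h)
    have im: "s ` (X <+> X) = X <+> X" "s ` (Y <+> {}) = Y <+> {}" "s ` ({} <+> Y) = {} <+> Y"
      using pres by auto
    have fix_all: "\<forall>v\<in>pverts G. k v = v" if "k \<in> graph_automorphisms G" "k ` X = X" "k ` Y = Y" for k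
      using col that by (simp add: distinguishing_coloring_def)
    have image: "s ` (A <+> B) = g ` A <+> h ` B" if "A \<subseteq> pverts G" "B \<subseteq> pverts G" for A B
    proof -
      have "s ` Inl ` A = Inl ` g ` A" "s ` Inr ` B = Inr ` h ` B"
        unfolding image_image using that keep(3,4) by (auto intro!: image_cong)
      then show ?thesis
        by (simp add: Plus_def image_Un)
    qed
    have "X \<subseteq> pverts G" "Y \<subseteq> pverts G"
      using XY(1) by auto
    \<comment> \<open>Comparing the two summands of each class separates the conditions on
      \<open>g\<close> from those on \<open>h\<close>.\<close>
    then have "g ` X <+> h ` X = X <+> X" "g ` Y <+> h ` {} = Y <+> {}" "g ` {} <+> h ` Y = {} <+> Y"
      by (metis image im(1), metis image im(2) empty_subsetI, metis image im(3) empty_subsetI)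
    then have "g ` X = X" "h ` X = X" "g ` Y = Y" "h ` Y = Y"
      by (simp_all add: Plus_eq_Plus_iff)
    then show ?thesis
      using fix_all keep by auto
  next
    case (swap g h)
    \<comment> \<open>\<open>Inl y\<close> lies in the class \<open>Y <+> {}\<close>, but an
      exchange sends it to a vertex of the form \<open>Inr\<close>, outside that class.\<close>
    obtain y where "y \<in> Y"
      using ne by auto
    then have "s (Inl y) \<in> s ` (Y <+> {})" "y \<in> pverts G"
      using XY by auto
    moreover have "s ` (Y <+> {}) = Y <+> {}"
      using pres by simp
    ultimately have "s (Inl y) \<in> Y <+> {}" "y \<in> pverts G"
      by simp_all
    then show ?thesis
      using swap by auto
  qed
  ultimately show ?thesis
    by (simp add: distinguishing_coloring_def)
qed

text \<open>Rigidity leaves the plain exchange as the only nontrivial automorphism of the union. The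
  opposite orientations defeat it: \<open>Inl x\<close> with \<open>x\<close> in \<open>X\<close>
  lies in \<open>X <+> Y\<close>, whereas \<open>Inr x\<close> does not.\<close>

lemma union_coloring_2:
  assumes wf: "pair_wf_digraph G" and conn: "connected (with_proj G)"
    and rigid: "graph_automorphisms G = {\<lambda>v\<in>pverts G. v}"
    and ne: "X \<noteq> {}" "Y \<noteq> {}" and bip: "bipartition G X Y"
  shows "distinguishing_coloring (G \<uplus>\<^sub>g G) 2 {X <+> Y, Y <+> X}"
proof -
  have XY: "X \<union> Y = pverts G" "X \<inter> Y = {}" "independent_set G X" "independent_set G Y"
    using bip by (auto simp: bipartition_def)
  have "partition_on (pverts (G \<uplus>\<^sub>g G)) {X <+> Y, Y <+> X}"
    by (rule partition_onI) (use XY ne in \<open>auto simp: disjnt_def\<close>)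
  moreover have "card {X <+> Y, Y <+> X} = 2"
  proof -
    have "X <+> Y \<noteq> Y <+> X"
      using ne XY by (auto simp: Plus_eq_Plus_iff)
    then show ?thesis
      by simp
  qed
  moreover have "\<forall>C\<in>{X <+> Y, Y <+> X}. independent_set (G \<uplus>\<^sub>g G) C"
    using XY by simp
  moreover have "\<forall>v\<in>pverts (G \<uplus>\<^sub>g G). s v = v"
    if s: "s \<in> graph_automorphisms (G \<uplus>\<^sub>g G)"
      and pres: "\<forall>C\<in>{X <+> Y, Y <+> X}. s ` C = C" for s
    using wf conn s
  proof (cases rule: connected_union_automorphism_cases)
    case (keep g h)
    then show ?thesis
      using rigid by auto
  next
    case (swap g h)
    obtain x where "x \<in> X"
      using ne by auto
    then have "s (Inl x) \<in> s ` (X <+> Y)" "x \<in> pverts G" "x \<notin> Y"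
      using XY by auto
    moreover have "s ` (X <+> Y) = X <+> Y"
      using pres by simp
    ultimately have "s (Inl x) \<in> X <+> Y" "x \<in> pverts G" "x \<notin> Y"
      by simp_all
    then show ?thesis
      using swap rigid by auto
  qed
  ultimately show ?thesis
    by (simp add: distinguishing_coloring_def)
qed

text \<open>Two color classes cut each copy into a bipartition of \<open>G\<close>. By uniqueness
  the two bipartitions have the same or the opposite orientation; the plain exchange preserves the
  classes in the first case, the exchange twisted by \<open>f\<close> in the second.\<close>

lemma union_chromatic_number_gt_2:
  assumes wf: "pair_wf_digraph G" and conn: "connected (with_proj G)"
    and f: "f \<in> graph_automorphisms G"
    and swaps: "\<And>X Y. bipartition G X Y \<Longrightarrow> f ` X = Y \<and> f ` Y = X"
  shows "\<not> \<chi>\<^sub>D (G \<uplus>\<^sub>g G) \<le> enat 2"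
proof
  let ?V = "pverts G"
  have ne: "?V \<noteq> {}"
    using conn by (rule connected_imp_nonempty)
  assume "\<chi>\<^sub>D (G \<uplus>\<^sub>g G) \<le> enat 2"
  then obtain j P where "j \<le> 2" and col: "distinguishing_coloring (G \<uplus>\<^sub>g G) j P"
    by (auto simp: distinguishing_chromatic_number_le_iff)
  have part: "partition_on (?V <+> ?V) P" "finite P" "card P = j"
    using col by (auto simp: distinguishing_coloring_def)
  \<comment> \<open>The case of the untwisted exchange: the restricted identity acts trivially on
    the traces of the classes, so it disappears from the formula.\<close>
  have no_id_swap: "\<not> (\<forall>C\<in>P. Inr ` (Inl -` C) \<union> Inl ` (Inr -` C) = C)"
  proof -
    have "(\<lambda>v\<in>?V. v) ` (Inl -` C) = Inl -` C" "(\<lambda>v\<in>?V. v) ` (Inr -` C) = Inr -` C"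
      if "C \<in> P" for C
    proof -
      have "Inl -` C \<subseteq> ?V" "Inr -` C \<subseteq> ?V"
        using that partition_onD1[OF part(1)] by auto
      then show "(\<lambda>v\<in>?V. v) ` (Inl -` C) = Inl -` C" "(\<lambda>v\<in>?V. v) ` (Inr -` C) = Inr -` C"
        by (auto simp: subset_iff image_iff)
    qed
    then show ?thesis
      using swap_not_class_preserving[OF col ne id_graph_automorphism] by auto
  qed
  from \<open>j \<le> 2\<close> consider "j = 0" | "j = 1" | "j = 2"
    by linarith
  then show False
  proof cases
    case 1
    then show ?thesis
      using part ne by (auto simp: partition_on_def)
  next
    case 2
    \<comment> \<open>A single class is the whole vertex set, which the plain exchange
      preserves.\<close>
    then have "P = {?V <+> ?V}"
      using part by (auto simp: card_1_singleton_iff partition_on_def)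
    moreover have "Inr ` (Inl -` (?V <+> ?V)) \<union> Inl ` (Inr -` (?V <+> ?V)) = ?V <+> ?V"
      by auto
    ultimately show ?thesis
      using no_id_swap by auto
  next
    case 3
    with col obtain A B where P: "P = {A, B}" and bip: "bipartition (G \<uplus>\<^sub>g G) A B"
      by (metis distinguishing_coloring_2_cases)
    have AB: "A \<union> B = ?V <+> ?V" "A \<inter> B = {}" "independent_set (G \<uplus>\<^sub>g G) A" "independent_set (G \<uplus>\<^sub>g G) B"
      using bip by (auto simp: bipartition_def)
    let ?A1 = "Inl -` A" and ?A2 = "Inr -` A" and ?B1 = "Inl -` B" and ?B2 = "Inr -` B"
    have bip1: "bipartition G ?A1 ?B1" and bip2: "bipartition G ?A2 ?B2"
    proof -
      have "?A1 \<union> ?B1 = ?V" "?A2 \<union> ?B2 = ?V"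
        unfolding vimage_Un[symmetric] AB(1) by auto
      moreover have "?A1 \<inter> ?B1 = {}" "?A2 \<inter> ?B2 = {}"
        using AB(2) by auto
      ultimately show "bipartition G ?A1 ?B1" "bipartition G ?A2 ?B2"
        using AB(3,4) by (auto simp: bipartition_def independent_set_disjoint_graph_union_iff)
    qed
    have split: "Inr ` (Inr -` C) \<union> Inl ` (Inl -` C) = C" for C :: "('a + 'a) set"
      by (auto simp: set_eq_iff split_sum_all)
    from connected_bipartition_unique[OF wf conn bip1 bip2] show ?thesis
    proof (elim disjE conjE)
      assume "?A2 = ?A1" "?B2 = ?B1"
      then show ?thesis
        using no_id_swap split[of A] split[of B] unfolding P by simp
    next
      assume *: "?A2 = ?B1" "?B2 = ?A1"
      \<comment> \<open>With opposite orientations the trace of \<open>A\<close> on the second copy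
        is the other part of \<open>G\<close>, which is what \<open>f\<close> makes of the trace on
        the first copy. Hence the twisted exchange preserves \<open>A\<close>, and likewise
        \<open>B\<close>.\<close>
      have "f ` ?A1 = ?A2" "f ` ?A2 = ?A1" "f ` ?B1 = ?B2" "f ` ?B2 = ?B1"
        using swaps[OF bip1] * by auto
      then show ?thesis
        using swap_not_class_preserving[OF col ne f] split[of A] split[of B]
        unfolding P by simp
    qed
  qed
qed

section \<open>Automorphisms of a connected graph with a distinguishing 2-coloring\<close>

lemma connected_automorphism_bipartition_cases:
  assumes wf: "pair_wf_digraph G" and conn: "connected (with_proj G)"
    and col: "distinguishing_coloring G 2 {X, Y}" and bip: "bipartition G X Y"
    and f: "f \<in> graph_automorphisms G"
  shows "f = (\<lambda>v\<in>pverts G. v) \<or> (f ` X = Y \<and> f ` Y = X)"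
proof -
  have "f = (\<lambda>v\<in>pverts G. v)" if "f ` X = X" "f ` Y = Y"
    by (rule graph_automorphisms_eqI[OF f id_graph_automorphism])
      (use distinguishing_coloring_fixes[OF col f] that in force)
  \<comment> \<open>The image of a bipartition is again a bipartition, so uniqueness leaves only
    preserving or exchanging the parts; preserving them was just shown to give the identity.\<close>
  then show ?thesis
    using connected_bipartition_unique[OF wf conn bip bipartition_image[OF f bip]] by auto
qed

text \<open>The composite of two automorphisms that exchange the parts preserves both parts and is
  therefore trivial. So \<open>f\<close> is its own inverse and \<open>g\<close> is also an inverse
  of \<open>f\<close>.\<close>

lemma swapping_automorphism_unique:
  assumes col: "distinguishing_coloring G 2 {X, Y}"
    and f: "f \<in> graph_automorphisms G" "f ` X = Y" "f ` Y = X"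
    and g: "g \<in> graph_automorphisms G" "g ` X = Y" "g ` Y = X"
  shows "g = f"
proof -
  have fix_all: "\<forall>v\<in>pverts G. k (f v) = v" if k: "k \<in> graph_automorphisms G" "k ` X = Y" "k ` Y = X" for k
  proof -
    have sub: "X \<subseteq> pverts G" "Y \<subseteq> pverts G"
      using col by (auto simp: distinguishing_coloring_def partition_on_def)
    have "compose (pverts G) k f ` C = k ` f ` C" if "C \<subseteq> pverts G" for C
      using that by (auto simp: compose_eq image_image subset_iff intro!: image_cong)
    then have "\<forall>C\<in>{X, Y}. compose (pverts G) k f ` C = C"
      using sub f k by simp
    moreover have "compose (pverts G) k f \<in> graph_automorphisms G"
      using f k by (intro compose_graph_automorphism)
    ultimately have "\<forall>v\<in>pverts G. compose (pverts G) k f v = v"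
      using col unfolding distinguishing_coloring_def by blast
    then show ?thesis
      by (simp add: compose_eq)
  qed
  show ?thesis
  proof (rule graph_automorphisms_eqI[OF g(1) f(1)])
    fix v assume "v \<in> pverts G"
    \<comment> \<open>Replacing \<open>v\<close> by \<open>f (f v)\<close> in \<open>g v\<close> and
      cancelling \<open>g\<close> against the outer \<open>f\<close> leaves
      \<open>f v\<close>.\<close>
    then have "v = f (f v)" "f v \<in> pverts G"
      using fix_all[OF f] graph_automorphisms_in_pverts[OF f(1)] by auto
    then show "g v = f v"
      using fix_all[OF g] by metis
  qed
qed

theorem theorem5p4:
  fixes G :: "'a pair_pre_digraph"
  assumes "pair_bidirected_digraph G"
    and "connected (with_proj G)"
    and "\<chi>\<^sub>D G = 2"
  shows "\<chi>\<^sub>D (G \<uplus>\<^sub>g G) = 3 \<longleftrightarrow>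
    bipartite G \<and>
    (\<exists>f. Aut_group G \<cong> integer_mod_group 2 \<and>
         carrier (Aut_group G) = {\<one>\<^bsub>Aut_group G\<^esub>, f} \<and>
         Fix G f = {} \<and>
         (\<forall>X Y. bipartition G X Y \<longrightarrow> f ` X = Y \<and> f ` Y = X))"
    (is "_ \<longleftrightarrow> ?R")
proof -
  note conn = assms(2)
  have wf: "pair_wf_digraph G"
    using assms(1) by (simp add: pair_bidirected_digraph_def pair_sym_digraph_def)
  have eq3: "\<chi>\<^sub>D (G \<uplus>\<^sub>g G) = 3 \<longleftrightarrow> \<chi>\<^sub>D (G \<uplus>\<^sub>g G) \<le> enat 3 \<and> \<not> \<chi>\<^sub>D (G \<uplus>\<^sub>g G) \<le> enat 2"
    using distinguishing_chromatic_number_eq_Suc_iff[of "G \<uplus>\<^sub>g G" 2]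
    by (simp add: numeral_eq_enat eval_nat_numeral)
  have "\<chi>\<^sub>D G \<le> enat 2 \<and> \<not> \<chi>\<^sub>D G \<le> enat 1"
    using assms(3) distinguishing_chromatic_number_eq_Suc_iff[of G 1]
    by (simp add: numeral_eq_enat eval_nat_numeral)
  \<comment> \<open>The upper bound yields a coloring with at most two classes; the failure of the
    bound 1 makes the number exactly two.\<close>
  then obtain P where "distinguishing_coloring G 2 P"
    unfolding distinguishing_chromatic_number_le_iff
    by (metis One_nat_def Suc_1 le_SucE)
  then obtain X Y where col: "distinguishing_coloring G 2 {X, Y}"
    and ne: "X \<noteq> {}" "Y \<noteq> {}" and bip: "bipartition G X Y"
    by (metis distinguishing_coloring_2_cases)
  \<comment> \<open>Three colors always suffice here, so the equivalence comes down to whether two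
    colors fail.\<close>
  have le3: "\<chi>\<^sub>D (G \<uplus>\<^sub>g G) \<le> enat 3"
    using union_coloring_3[OF wf conn col ne bip] distinguishing_chromatic_number_le_iff by blast
  let ?id = "\<lambda>v\<in>pverts G. v"
  show ?thesis
  proof
    assume "\<chi>\<^sub>D (G \<uplus>\<^sub>g G) = 3"
    \<comment> \<open>Were \<open>G\<close> rigid, the oppositely oriented coloring would need only
      two colors.\<close>
    then have "graph_automorphisms G \<noteq> {?id}"
      using eq3 union_coloring_2[OF wf conn _ ne bip] distinguishing_chromatic_number_le_iff by blast
    then obtain f where f: "f \<in> graph_automorphisms G" "f \<noteq> ?id"
      using id_graph_automorphism[of G] by blast
    then have swap: "f ` X = Y" "f ` Y = X"
      using connected_automorphism_bipartition_cases[OF wf conn col bip] by blast+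
    have "g = ?id \<or> g = f" if "g \<in> graph_automorphisms G" for g
      using connected_automorphism_bipartition_cases[OF wf conn col bip that]
        swapping_automorphism_unique[OF col f(1) swap that] by argo
    then have aut: "graph_automorphisms G = {?id, f}"
      using f(1) id_graph_automorphism[of G] by fast
    then have "Aut_group G \<cong> integer_mod_group 2"
      using f(2) group_Aut_group by (intro group_order_2_iso[of _ f]) auto
    moreover have "Fix G f = {}"
    proof -
      have "f v \<noteq> v" if "v \<in> pverts G" for v
      proof (cases "v \<in> X")
        case True
        then have "f v \<in> Y"
          using swap(1) by (metis imageI)
        with True show ?thesis
          using bip unfolding bipartition_def by (metis disjoint_iff)
      next
        case False
        then have "v \<in> Y"
          using that bip unfolding bipartition_def by (metis UnE)
        then have "f v \<in> X"
          using swap(2) by (metis imageI)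
        with False show ?thesis
          by metis
      qed
      then show ?thesis
        by (simp add: Fix_def)
    qed
    \<comment> \<open>Every bipartition is the one given by the coloring, up to the order of its
      parts.\<close>
    moreover have "f ` X' = Y' \<and> f ` Y' = X'" if "bipartition G X' Y'" for X' Y'
      using connected_bipartition_unique[OF wf conn bip that] swap by auto
    ultimately show ?R
      using aut bip unfolding bipartite_def by (intro conjI exI[of _ f]) auto
  next
    assume ?R
    then obtain f where "f \<in> graph_automorphisms G"
      "\<And>X Y. bipartition G X Y \<Longrightarrow> f ` X = Y \<and> f ` Y = X"
      by auto
    then show "\<chi>\<^sub>D (G \<uplus>\<^sub>g G) = 3"
      using eq3 le3 union_chromatic_number_gt_2[OF wf conn] by blast
  qed
qed

end
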